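(* Every prime ideal of $\mathbb{K}\langle z\rangle$ is contained in a unique maximal ideal of $\mathbb{K}\langle z\rangle$.
   Context: $\mathbb{K}\langle z\rangle$ denotes any one of the following three rings (the statement is meant for each of them): (1) the ring $\mathbb{C}\langle z\rangle$ of complex entire functions of one variable; (2) the ring $\mathbb{C}\langle x\rangle$ of convergent power series $\sum_{n\ge 0}a_nz^n$ in one complex variable $z\in\mathbb{C}$ with real coefficients $a_n\in\mathbb{R}$; (3) the ring $\mathbb{R}\langle x\rangle$ of real analytic functions of one real variable (functions on $\mathbb{R}$ given locally by convergent power series in one real variable with real coefficients). All rings have pointwise operations.
   Formalization: The prime ideal is assumed to be nonzero, since the zero ideal is prime in each of the three rings but lies in several maximal ideals, such as the functions vanishing at 0 and those vanishing at 1. *)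

theory Defs
  imports "HOL-Complex_Analysis.Complex_Analysis" "HOL-Algebra.Ideal"
begin

definition function_ring :: "('a \<Rightarrow> 'b::comm_ring_1) set \<Rightarrow> ('a \<Rightarrow> 'b) ring" where
  "function_ring F = \<lparr>carrier = F, monoid.mult = (\<lambda>f g x. f x * g x), one = (\<lambda>x. 1),
     zero = (\<lambda>x. 0), add = (\<lambda>f g x. f x + g x)\<rparr>"

definition entire_ring :: "(complex \<Rightarrow> complex) ring" where
  "entire_ring = function_ring {f. f holomorphic_on UNIV}"

text \<open>The power series below are required to converge at every complex number, so these are the
  entire functions with real Taylor coefficients at the origin.\<close>

definition real_entire_ring :: "(complex \<Rightarrow> complex) ring" where
  "real_entire_ring = function_ring
     {f. \<exists>a :: nat \<Rightarrow> real. \<forall>z. (\<lambda>n. complex_of_real (a n) * z ^ n) sums f z}"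

definition real_analytic :: "(real \<Rightarrow> real) \<Rightarrow> bool" where
  "real_analytic f \<longleftrightarrow> (\<forall>x0. \<exists>r>0. \<exists>a :: nat \<Rightarrow> real.
     \<forall>x. \<bar>x - x0\<bar> < r \<longrightarrow> (\<lambda>n. a n * (x - x0) ^ n) sums f x)"

definition real_analytic_ring :: "(real \<Rightarrow> real) ring" where
  "real_analytic_ring = function_ring {f. real_analytic f}"

text \<open>Each of these rings is an integral domain, so its zero ideal satisfies \<^const>\<open>primeideal\<close>. The
  zero ideal lies in every maximal ideal, in particular in those of the functions vanishing at 0 and
  at 1, so a unique maximal ideal above a prime ideal can only be expected for nonzero prime ideals.\<close>

end

theory Submission
  imports Defs "HOL-Algebra.Ring_Divisibility"
begin

text \<open>
  Suppose that a prime ideal \<open>P\<close> containing a function \<open>f \<noteq> 0\<close> lies in two different maximal ideals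
  \<open>M\<close> and \<open>N\<close>. Then \<open>m + n = 1\<close> for some \<open>m \<in> M\<close> and \<open>n \<in> N\<close>, so \<open>m\<close> and \<open>n\<close> have no common zero. The
  zeros of \<open>f\<close> can therefore be distributed, with their multiplicities, over two factors: \<open>g\<close> gets
  those where \<open>n\<close> does not vanish, and \<open>h\<close> gets those where \<open>n\<close> vanishes, where \<open>m\<close> takes the value 1.
  If functions without common zeros always generate the unit ideal, then \<open>g\<close> and \<open>n\<close> generate it, so
  \<open>g \<notin> N\<close>, and \<open>h\<close> and \<open>m\<close> generate it, so \<open>h \<notin> M\<close>. Both factors thus lie outside \<open>P\<close>, although their
  product lies in \<open>P\<close>. This contradiction is \<open>function_ring_unique_maximal\<close>; it asks for
  \<open>g h\<close> to be a multiple of \<open>f\<close>, and in the two real rings it will be \<open>f\<^sup>2\<close>.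

  Two analytic facts remain for each ring: the distribution of the zeros, and the Bezout property.

  For entire functions, the zeros are distributed by the Weierstrass factorization on the plane with
  the zeros reserved for \<open>h\<close> removed (\<open>entire_split_zeros\<close>). The Bezout property (\<open>entire_bezout\<close>) is
  algebra on a disc, where only finitely many zeros matter; solutions on growing discs are then
  corrected by polynomials so as to converge on the whole plane.

  The entire functions with real Taylor coefficients are those fixed by the involution
  \<open>f \<mapsto> (z \<mapsto> cnj (f (cnj z)))\<close>. A Bezout identity becomes real by averaging it with its conjugate. A
  factorization \<open>f = g h\<close> need not be real, but multiplying it by its conjugate gives one of \<open>f\<^sup>2\<close> with
  real factors.

  For real analytic functions, the Bezout property is immediate, as a sum of two squares without
  common zero is a unit. To distribute the zeros, \<open>f\<close> is extended holomorphically to a neighbourhood of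
  the real line, where it is an entire function times a function without zeros
  (\<open>real_analytic_factor_entire\<close>); the zeros of the entire factor are distributed as before, and
  squared absolute values make the result real.
\<close>

section \<open>Comaximal elements and prime ideals\<close>

text \<open>By Zorn's lemma: a union of a nonempty chain of ideals avoiding \<open>\<one>\<close> is an ideal avoiding \<open>\<one>\<close>.\<close>
lemma (in cring) ex_maximalideal_above:
  assumes I: "ideal I R" and proper: "I \<noteq> carrier R"
  shows "\<exists>M. maximalideal M R \<and> I \<subseteq> M"
proof -
  define S where "S = {J. ideal J R \<and> I \<subseteq> J \<and> \<one> \<notin> J}"
  have "\<exists>M\<in>S. \<forall>J\<in>S. M \<subseteq> J \<longrightarrow> J = M"
  proof (rule subset_Zorn_nonempty)
    show "S \<noteq> {}"
      using I proper ideal.one_imp_carrier by (auto simp: S_def)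
  next
    fix C assume C: "C \<noteq> {}" "subset.chain S C"
    have "subset.chain {J. ideal J R} C"
      using C(2) by (auto simp: pred_on.chain_def S_def)
    from chain_Union_is_ideal[OF this] C(1) have "ideal (\<Union>C) R" by simp
    then show "\<Union>C \<in> S"
      using C by (auto simp: pred_on.chain_def S_def)
  qed
  then obtain M where M: "M \<in> S" "\<And>J. J \<in> S \<Longrightarrow> M \<subseteq> J \<Longrightarrow> J = M" by blast
  have "maximalideal M R"
  proof (rule maximalidealI)
    show "ideal M R" "carrier R \<noteq> M" using M(1) one_closed by (auto simp: S_def)
  next
    fix J assume J: "ideal J R" "M \<subseteq> J" "J \<subseteq> carrier R"
    show "J = M \<or> J = carrier R"
    proof (cases "\<one> \<in> J")
      case True
      then show ?thesis using ideal.one_imp_carrier[OF J(1)] by simp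
    next
      case False
      then have "J \<in> S" using J M(1) by (auto simp: S_def)
      then show ?thesis using M(2) J(2) by simp
    qed
  qed
  then show ?thesis using M(1) by (auto simp: S_def)
qed

text \<open>The ideal \<open>M <+> N\<close> contains \<open>M\<close> properly, so it is the whole ring.\<close>
lemma (in cring) distinct_maximalideals_comaximal:
  assumes M: "maximalideal M R" and N: "maximalideal N R" and "M \<noteq> N"
  obtains m n where "m \<in> M" "n \<in> N" "m \<oplus> n = \<one>"
proof -
  interpret M: maximalideal M R by fact
  interpret N: maximalideal N R by fact
  have id: "ideal (M <+> N) R" by (rule add_ideals[OF M.is_ideal N.is_ideal])
  have MS: "M \<subseteq> M <+> N"
  proof
    fix x assume "x \<in> M"
    then have "x = x \<oplus> \<zero>" by (simp add: M.Icarr)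
    with \<open>x \<in> M\<close> N.zero_closed show "x \<in> M <+> N" unfolding set_add_def' by blast
  qed
  have NS: "N \<subseteq> M <+> N"
  proof
    fix x assume "x \<in> N"
    then have "x = \<zero> \<oplus> x" by (simp add: N.Icarr)
    with \<open>x \<in> N\<close> M.zero_closed show "x \<in> M <+> N" unfolding set_add_def' by blast
  qed
  have SC: "M <+> N \<subseteq> carrier R" using id by (simp add: ideal.Icarr subsetI)
  have "M <+> N = carrier R"
  proof (rule ccontr)
    assume "M <+> N \<noteq> carrier R"
    with M.I_maximal[OF id MS SC] have "N \<subseteq> M" using NS by simp
    then have "M = N \<or> M = carrier R"
      using N.I_maximal[OF M.is_ideal] M.a_subset by blast
    with \<open>M \<noteq> N\<close> M.I_notcarr show False by simp
  qed
  then have "\<one> \<in> M <+> N" by simp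
  then show ?thesis using that unfolding set_add_def' by auto
qed

text \<open>The hypothesis \<open>split\<close> forbids \<open>P\<close> to lie in two maximal ideals \<open>M \<noteq> N\<close>: apply it to \<open>m \<in> M\<close> and
  \<open>n \<in> N\<close> with \<open>m \<oplus> n = \<one>\<close>. The factor \<open>g\<close> is comaximal with an element of \<open>N\<close>, hence not in
  \<open>N \<supseteq> P\<close>, and likewise \<open>h \<notin> P\<close>, against primality.\<close>
lemma (in cring) primeideal_unique_maximal:
  assumes P: "primeideal P R"
    and split: "\<And>m n. \<lbrakk>m \<in> carrier R; n \<in> carrier R; m \<oplus> n = \<one>\<rbrakk> \<Longrightarrow>
      \<exists>g\<in>carrier R. \<exists>h\<in>carrier R. g \<otimes> h \<in> P \<and>
        (\<exists>a\<in>carrier R. \<exists>b\<in>carrier R. a \<otimes> g \<oplus> b \<otimes> n = \<one>) \<and>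
        (\<exists>a\<in>carrier R. \<exists>b\<in>carrier R. a \<otimes> h \<oplus> b \<otimes> m = \<one>)"
  shows "\<exists>!M. maximalideal M R \<and> P \<subseteq> M"
proof -
  interpret P: primeideal P R by fact
  \<comment> \<open>A multiple of \<open>u \<in> P\<close> plus a multiple of \<open>v \<in> J\<close> cannot be \<open>\<one>\<close>.\<close>
  have notin: "u \<notin> P"
    if J: "maximalideal J R" "P \<subseteq> J" and v: "v \<in> J"
      and ab: "a \<in> carrier R" "b \<in> carrier R" "a \<otimes> u \<oplus> b \<otimes> v = \<one>" for J u v a b
  proof
    interpret J: maximalideal J R by fact
    assume "u \<in> P"
    then have "a \<otimes> u \<oplus> b \<otimes> v \<in> J"
      using J(2) v ab by (intro J.a_closed J.I_l_closed) auto
    with ab(3) have "J = carrier R" using J.one_imp_carrier by simp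
    with J.I_notcarr show False by simp
  qed
  have "M = N" if M: "maximalideal M R" "P \<subseteq> M" and N: "maximalideal N R" "P \<subseteq> N" for M N
  proof (rule ccontr)
    assume "M \<noteq> N"
    then obtain m n where mn: "m \<in> M" "n \<in> N" "m \<oplus> n = \<one>"
      using distinct_maximalideals_comaximal[OF M(1) N(1)] by blast
    have "m \<in> carrier R" "n \<in> carrier R"
      using mn M(1) N(1) by (meson ideal.Icarr maximalideal.axioms(1))+
    from split[OF this mn(3)] obtain g h a b c d
      where gh: "g \<in> carrier R" "h \<in> carrier R" "g \<otimes> h \<in> P"
        and ab: "a \<in> carrier R" "b \<in> carrier R" "a \<otimes> g \<oplus> b \<otimes> n = \<one>"
        and cd: "c \<in> carrier R" "d \<in> carrier R" "c \<otimes> h \<oplus> d \<otimes> m = \<one>" by blast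
    have "g \<notin> P" by (rule notin[OF N mn(2) ab])
    moreover have "h \<notin> P" by (rule notin[OF M mn(1) cd])
    ultimately show False using P.I_prime[OF gh] by blast
  qed
  moreover have "\<exists>M. maximalideal M R \<and> P \<subseteq> M"
    by (rule ex_maximalideal_above[OF P.is_ideal]) (use P.I_notcarr in auto)
  ultimately show ?thesis by blast
qed

lemma function_ring_cring:
  fixes F :: "('a \<Rightarrow> 'b::comm_ring_1) set"
  assumes one: "(\<lambda>x. 1) \<in> F"
    and add: "\<And>f g. f \<in> F \<Longrightarrow> g \<in> F \<Longrightarrow> (\<lambda>x. f x + g x) \<in> F"
    and mult: "\<And>f g. f \<in> F \<Longrightarrow> g \<in> F \<Longrightarrow> (\<lambda>x. f x * g x) \<in> F"
    and minus: "\<And>f. f \<in> F \<Longrightarrow> (\<lambda>x. - f x) \<in> F"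
  shows "cring (function_ring F)"
proof (rule cringI)
  have zero: "(\<lambda>x. 0) \<in> F" using add[OF one minus[OF one]] by simp
  show "abelian_group (function_ring F)"
  proof (rule abelian_groupI, goal_cases)
    case (6 f)
    then show ?case
      by (intro bexI[of _ "\<lambda>x. - f x"]) (auto simp: function_ring_def intro: minus)
  qed (auto simp: function_ring_def add zero algebra_simps)
  show "comm_monoid (function_ring F)"
    by (rule comm_monoidI) (auto simp: function_ring_def one mult algebra_simps)
qed (auto simp: function_ring_def algebra_simps)

text \<open>The ring-theoretic argument in terms of functions. The nonzero function \<open>f\<close> is an arbitrary nonzero
  element of \<open>P\<close>. The extra factor \<open>e\<close> leaves room for splitting a multiple of \<open>f\<close>, such as its square,
  instead of \<open>f\<close> itself.\<close>
lemma function_ring_unique_maximal: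
  fixes F :: "('a \<Rightarrow> 'b::comm_ring_1) set"
  assumes one: "(\<lambda>x. 1) \<in> F"
    and add: "\<And>f g. f \<in> F \<Longrightarrow> g \<in> F \<Longrightarrow> (\<lambda>x. f x + g x) \<in> F"
    and mult: "\<And>f g. f \<in> F \<Longrightarrow> g \<in> F \<Longrightarrow> (\<lambda>x. f x * g x) \<in> F"
    and minus: "\<And>f. f \<in> F \<Longrightarrow> (\<lambda>x. - f x) \<in> F"
    and split: "\<And>f m n. \<lbrakk>f \<in> F; f \<noteq> (\<lambda>x. 0); m \<in> F; n \<in> F; \<And>x. m x + n x = 1\<rbrakk> \<Longrightarrow>
      \<exists>e\<in>F. \<exists>g\<in>F. \<exists>h\<in>F. (\<forall>x. g x * h x = e x * f x) \<and>
        (\<exists>a\<in>F. \<exists>b\<in>F. \<forall>x. a x * g x + b x * n x = 1) \<and>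
        (\<exists>a\<in>F. \<exists>b\<in>F. \<forall>x. a x * h x + b x * m x = 1)"
    and P: "primeideal P (function_ring F)" "P \<noteq> {\<zero>\<^bsub>function_ring F\<^esub>}"
  shows "\<exists>!M. maximalideal M (function_ring F) \<and> P \<subseteq> M"
proof -
  interpret cring "function_ring F" by (rule function_ring_cring[OF one add mult minus])
  interpret P: primeideal P "function_ring F" by fact
  have "(\<lambda>x. 0) \<in> P" using P.zero_closed by (simp add: function_ring_def)
  with P(2) obtain f where f: "f \<in> P" "f \<noteq> (\<lambda>x. 0)" by (auto simp: function_ring_def)
  have fF: "f \<in> F" using P.Icarr[OF f(1)] by (simp add: function_ring_def)
  show ?thesis
  proof (rule primeideal_unique_maximal[OF P(1)])
    fix m n assume mn: "m \<in> carrier (function_ring F)" "n \<in> carrier (function_ring F)"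
      "m \<oplus>\<^bsub>function_ring F\<^esub> n = \<one>\<^bsub>function_ring F\<^esub>"
    then have mn': "m \<in> F" "n \<in> F" "\<And>x. m x + n x = 1"
      by (auto simp: function_ring_def fun_eq_iff)
    from split[OF fF f(2) mn'] obtain e g h where egh: "e \<in> F" "g \<in> F" "h \<in> F"
        "\<forall>x. g x * h x = e x * f x"
      and 1: "\<exists>a\<in>F. \<exists>b\<in>F. \<forall>x. a x * g x + b x * n x = 1"
      and 2: "\<exists>a\<in>F. \<exists>b\<in>F. \<forall>x. a x * h x + b x * m x = 1" by blast
    have "e \<otimes>\<^bsub>function_ring F\<^esub> f \<in> P"
      using P.I_l_closed[OF f(1)] egh(1) by (simp add: function_ring_def)
    then have "g \<otimes>\<^bsub>function_ring F\<^esub> h \<in> P"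
      using egh(4) by (simp add: function_ring_def)
    with egh 1 2 show "\<exists>g\<in>carrier (function_ring F). \<exists>h\<in>carrier (function_ring F).
        g \<otimes>\<^bsub>function_ring F\<^esub> h \<in> P \<and>
        (\<exists>a\<in>carrier (function_ring F). \<exists>b\<in>carrier (function_ring F).
          a \<otimes>\<^bsub>function_ring F\<^esub> g \<oplus>\<^bsub>function_ring F\<^esub> b \<otimes>\<^bsub>function_ring F\<^esub> n = \<one>\<^bsub>function_ring F\<^esub>) \<and>
        (\<exists>a\<in>carrier (function_ring F). \<exists>b\<in>carrier (function_ring F).
          a \<otimes>\<^bsub>function_ring F\<^esub> h \<oplus>\<^bsub>function_ring F\<^esub> b \<otimes>\<^bsub>function_ring F\<^esub> m = \<one>\<^bsub>function_ring F\<^esub>)"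
      by (intro bexI[of _ g] bexI[of _ h]) (auto simp: function_ring_def fun_eq_iff)
  qed
qed

section \<open>Distributing the zeros of an entire function\<close>

lemma entire_zeros_sparse:
  assumes "f holomorphic_on UNIV" "f \<noteq> (\<lambda>z. 0)"
  shows "{z. f z = 0} sparse_in UNIV"
proof -
  obtain b where b: "f b \<noteq> 0" using assms(2) by auto
  have "\<forall>\<^sub>F w in at z. f w \<noteq> 0" for z
    using non_zero_neighbour_alt[OF assms(1) open_UNIV connected_UNIV _ _ b, of z] by auto
  then show ?thesis by (simp add: sparse_in_eventually_iff)
qed

text \<open>Let \<open>T\<close> be the set of zeros of \<open>f\<close> outside \<open>A\<close>. It is discrete, so its complement is open and
  connected, and the zeros of \<open>f\<close> do not accumulate anywhere. The Weierstrass factorization of \<open>f\<close> on the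
  complement of \<open>T\<close> therefore yields an entire \<open>g\<close> that has exactly the zeros of \<open>f\<close> in \<open>A\<close>, with the
  same multiplicities. The quotient \<open>h\<close> is holomorphic off \<open>T\<close> by this factorization, and near \<open>T\<close>
  because \<open>g\<close> has no zero there.\<close>
lemma entire_split_zeros:
  assumes f: "f holomorphic_on UNIV" "f \<noteq> (\<lambda>z. 0)"
  obtains g h where "g holomorphic_on UNIV" "h holomorphic_on UNIV" "\<And>z. f z = g z * h z"
    "\<And>z. g z = 0 \<longleftrightarrow> f z = 0 \<and> z \<in> A" "\<And>z. h z = 0 \<longleftrightarrow> f z = 0 \<and> z \<notin> A"
proof -
  define T where "T = {z. f z = 0 \<and> z \<notin> A}"
  obtain b where b: "f b \<noteq> 0" using f(2) by auto
  have sp: "{z. f z = 0} sparse_in UNIV" by (rule entire_zeros_sparse[OF f])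
  have lim: "\<not> z islimpt {z. f z = 0}" for z using sp by (simp add: sparse_in_open)
  have T_sp: "T sparse_in UNIV" by (rule sparse_in_subset2[OF sp]) (auto simp: T_def)
  have op: "open (UNIV - T)" by (rule open_diff_sparse_pts[OF open_UNIV T_sp])
  have conn: "connected (UNIV - T)"
    by (rule sparse_imp_connected[OF _ connected_UNIV open_UNIV T_sp]) simp
  have hol: "f holomorphic_on UNIV - T" by (rule holomorphic_on_subset[OF f(1)]) simp
  have fr: "\<not> z islimpt {w \<in> UNIV - T. f w = 0}" if "z \<in> frontier (UNIV - T)" for z
    using lim[of z] islimpt_subset[of z "{w \<in> UNIV - T. f w = 0}" "{z. f z = 0}"] by auto
  obtain u g where ug: "u holomorphic_on UNIV - T" "g holomorphic_on UNIV"
    "\<forall>z. g z = 0 \<longleftrightarrow> (\<forall>z\<in>UNIV - T. f z = 0) \<or> (z \<in> UNIV - T \<and> f z = 0)"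
    "\<forall>z\<in>UNIV - T. u z \<noteq> 0" "\<forall>z\<in>UNIV - T. f z = u z * g z"
    by (rule weierstrass_factorization[OF hol op conn fr]) blast
  have bT: "b \<in> UNIV - T" using b by (simp add: T_def)
  have g0: "g z = 0 \<longleftrightarrow> f z = 0 \<and> z \<in> A" for z
    using ug(3) b bT by (auto simp: T_def)
  define h where "h = (\<lambda>z. if z \<in> UNIV - T then u z else f z / g z)"
  have "closed {z. g z = 0}"
    using ug(2) by (intro closed_Collect_eq holomorphic_on_imp_continuous_on continuous_on_const)
  then have opg: "open {z. g z \<noteq> 0}" by (simp add: closed_def Compl_eq)
  have "h holomorphic_on (UNIV - T) \<union> {z. g z \<noteq> 0}"
    unfolding h_def
  proof (rule holomorphic_on_If_Un)
    show "(\<lambda>z. f z / g z) holomorphic_on {z. g z \<noteq> 0}"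
      by (intro holomorphic_on_divide holomorphic_on_subset[OF f(1)] holomorphic_on_subset[OF ug(2)]) auto
    show "u z = f z / g z" if "z \<in> UNIV - T" "z \<in> {z. g z \<noteq> 0}" for z
      using that ug(5) by simp
  qed (use ug(1) op opg in auto)
  moreover have "(UNIV - T) \<union> {z. g z \<noteq> 0} = UNIV" by (auto simp: g0 T_def)
  ultimately have h: "h holomorphic_on UNIV" by simp
  have hT: "h z = f z / g z" "g z \<noteq> 0" "f z = 0" "z \<notin> A" if "z \<in> T" for z
    using that g0[of z] by (auto simp: h_def T_def)
  have hnT: "h z = u z" "f z = u z * g z" "u z \<noteq> 0" if "z \<notin> T" for z
    using that ug(4,5) by (simp_all add: h_def)
  have "f z = g z * h z" for z
    by (cases "z \<in> T") (simp_all add: hT hnT)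
  moreover have "h z = 0 \<longleftrightarrow> f z = 0 \<and> z \<notin> A" for z
  proof (cases "z \<in> T")
    case False
    then show ?thesis using hnT(1,3)[OF False] by (simp add: T_def)
  qed (simp add: hT)
  ultimately show ?thesis using that[OF ug(2) h] g0 by metis
qed

section \<open>The Bezout property of entire functions\<close>

text \<open>Near \<open>w\<close> the quotient is given by the local factorization at a zero, elsewhere by division.\<close>
lemma entire_factor_at:
  fixes w :: complex
  assumes f: "f holomorphic_on UNIV" "f \<noteq> (\<lambda>z. 0)"
  obtains n q where "q holomorphic_on UNIV" "q w \<noteq> 0" "\<And>z. f z = (z - w) ^ n * q z"
proof -
  have ex: "\<exists>v\<in>UNIV. f v \<noteq> 0" using f(2) by auto
  obtain r where r: "r > 0" "zor_poly f w holomorphic_on cball w r"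
    "\<forall>z\<in>cball w r. f z = zor_poly f w z * (z - w) ^ nat (zorder f w) \<and> zor_poly f w z \<noteq> 0"
    using zorder_exist_zero[OF f(1) open_UNIV connected_UNIV UNIV_I ex, of w] by auto
  define n where "n = nat (zorder f w)"
  define q where "q = (\<lambda>z. if z \<in> ball w r then zor_poly f w z else f z / (z - w) ^ n)"
  have "q holomorphic_on ball w r \<union> (UNIV - {w})"
    unfolding q_def
  proof (rule holomorphic_on_If_Un)
    show "zor_poly f w holomorphic_on ball w r" by (rule holomorphic_on_subset[OF r(2)]) auto
    show "(\<lambda>z. f z / (z - w) ^ n) holomorphic_on UNIV - {w}"
      by (intro holomorphic_intros holomorphic_on_subset[OF f(1)]) auto
    show "zor_poly f w z = f z / (z - w) ^ n" if "z \<in> ball w r" "z \<in> UNIV - {w}" for z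
      using that r(3) by (simp add: n_def)
  qed auto
  moreover have "ball w r \<union> (UNIV - {w}) = UNIV" using r(1) by auto
  ultimately have "q holomorphic_on UNIV" by simp
  moreover have "q w \<noteq> 0" using r by (simp add: q_def)
  moreover have "f z = (z - w) ^ n * q z" for z
    using r by (auto simp: q_def n_def)
  ultimately show ?thesis using that by blast
qed

text \<open>Comaximality in the ring of holomorphic functions on \<open>S\<close>. The set is a parameter because the Bezout
  identity is first solved on discs.\<close>
definition comaximal_on :: "complex set \<Rightarrow> (complex \<Rightarrow> complex) \<Rightarrow> (complex \<Rightarrow> complex) \<Rightarrow> bool" where
  "comaximal_on S f g \<longleftrightarrow> (\<exists>a b. a holomorphic_on S \<and> b holomorphic_on S \<and>
     (\<forall>z\<in>S. f z * a z + g z * b z = 1))"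

text \<open>As in any commutative ring, comaximality with \<open>f\<close> is multiplicative: multiply the two identities.\<close>
lemma comaximal_on_mult:
  assumes f: "f holomorphic_on S" and u: "u holomorphic_on S" and v: "v holomorphic_on S"
    and fu: "comaximal_on S f u" and fv: "comaximal_on S f v"
  shows "comaximal_on S f (\<lambda>z. u z * v z)"
proof -
  obtain a b where ab: "a holomorphic_on S" "b holomorphic_on S" "\<forall>z\<in>S. f z * a z + u z * b z = 1"
    using fu by (auto simp: comaximal_on_def)
  obtain c d where cd: "c holomorphic_on S" "d holomorphic_on S" "\<forall>z\<in>S. f z * c z + v z * d z = 1"
    using fv by (auto simp: comaximal_on_def)
  let ?a = "\<lambda>z. a z * (f z * c z + v z * d z) + u z * b z * c z"
  have "f z * ?a z + (u z * v z) * (b z * d z) = 1" if "z \<in> S" for z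
  proof -
    have "f z * ?a z + (u z * v z) * (b z * d z) =
        (f z * a z + u z * b z) * (f z * c z + v z * d z)"
      by (simp add: algebra_simps)
    then show ?thesis using ab(3) cd(3) that by simp
  qed
  moreover have "?a holomorphic_on S" "(\<lambda>z. b z * d z) holomorphic_on S"
    by (intro holomorphic_intros ab cd f u v)+
  ultimately show ?thesis unfolding comaximal_on_def by blast
qed

lemma comaximal_on_power:
  assumes f: "f holomorphic_on S" and u: "u holomorphic_on S" and fu: "comaximal_on S f u"
  shows "comaximal_on S f (\<lambda>z. u z ^ n)"
proof (induction n)
  case 0
  then show ?case
    unfolding comaximal_on_def by (intro exI[of _ "\<lambda>z. 0"] exI[of _ "\<lambda>z. 1"]) auto
next
  case (Suc n)
  then show ?case
    using comaximal_on_mult[OF f u _ fu Suc] u by (simp add: holomorphic_on_power)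
qed

text \<open>Since \<open>f z - f w\<close> is divisible by \<open>z - w\<close>, the constant \<open>f w \<noteq> 0\<close> is a combination of the two.\<close>
lemma comaximal_on_linear:
  fixes w :: complex
  assumes f: "f holomorphic_on UNIV" and w: "f w \<noteq> 0"
  shows "comaximal_on S f (\<lambda>z. z - w)"
proof -
  define q where "q = (\<lambda>z. if z = w then deriv f w else (f z - f w) / (z - w))"
  have q: "q holomorphic_on S"
    unfolding q_def by (rule holomorphic_on_subset[OF pole_lemma_open[OF f open_UNIV]]) simp
  have "f z * (1 / f w) + (z - w) * (- q z / f w) = 1" for z
    using w by (auto simp: q_def field_simps)
  moreover have "(\<lambda>z. - q z / f w) holomorphic_on S"
    using q w by (intro holomorphic_intros) auto
  ultimately show ?thesis
    unfolding comaximal_on_def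
    by (intro exI[of _ "\<lambda>z. 1 / f w"] exI[of _ "\<lambda>z. - q z / f w"]) auto
qed

text \<open>Splitting off zeros at the points of \<open>Z\<close> one by one writes \<open>g\<close> as a product of powers of linear
  functions and a function without zeros in \<open>S\<close>; each factor is comaximal with \<open>f\<close>.\<close>
lemma comaximal_on_finite_zeros:
  assumes "finite Z" and f: "f holomorphic_on UNIV" and fZ: "\<And>w. w \<in> Z \<Longrightarrow> f w \<noteq> 0"
    and g: "g holomorphic_on UNIV" "g \<noteq> (\<lambda>z. 0)" and gS: "\<And>z. z \<in> S - Z \<Longrightarrow> g z \<noteq> 0"
  shows "comaximal_on S f g"
  using assms(1) fZ g gS
proof (induction Z arbitrary: g rule: finite_induct)
  case empty
  have "(\<lambda>z. 1 / g z) holomorphic_on S"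
    using empty by (intro holomorphic_intros holomorphic_on_subset[OF empty(2)]) auto
  then show ?case
    unfolding comaximal_on_def using empty
    by (intro exI[of _ "\<lambda>z. 0"] exI[of _ "\<lambda>z. 1 / g z"]) auto
next
  case (insert w Z)
  obtain n q where q: "q holomorphic_on UNIV" "q w \<noteq> 0" "\<And>z. g z = (z - w) ^ n * q z"
    using entire_factor_at[OF insert.prems(2,3)] by metis
  have "q z \<noteq> 0" if "z \<in> S - Z" for z
    using insert.prems(4)[of z] that q(2,3) by (cases "z = w") auto
  then have "comaximal_on S f q"
    using insert.prems(1) q(1,2) by (intro insert.IH) auto
  moreover have "comaximal_on S f (\<lambda>z. (z - w) ^ n)"
    using insert.prems(1) by (intro comaximal_on_power comaximal_on_linear f
        holomorphic_on_subset[OF f] holomorphic_intros) auto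
  moreover have "g = (\<lambda>z. (z - w) ^ n * q z)" using q(3) by blast
  moreover have "f holomorphic_on S" "q holomorphic_on S"
    using f q(1) by (auto intro: holomorphic_on_subset)
  moreover have "(\<lambda>z. (z - w) ^ n) holomorphic_on S" by (intro holomorphic_intros)
  ultimately show ?case by (simp add: comaximal_on_mult)
qed

text \<open>A disc contains only finitely many zeros of \<open>g\<close>, by compactness of its closure.\<close>
lemma comaximal_on_ball:
  assumes f: "f holomorphic_on UNIV" and g: "g holomorphic_on UNIV" "g \<noteq> (\<lambda>z. 0)"
    and fg: "\<And>z. \<not> (f z = 0 \<and> g z = 0)"
  shows "comaximal_on (ball 0 r) f g"
proof (rule comaximal_on_finite_zeros[OF _ f _ g])
  have "{z. g z = 0} sparse_in UNIV" by (rule entire_zeros_sparse[OF g])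
  then have lim: "\<not> z islimpt {z. g z = 0}" for z by (simp add: sparse_in_open)
  show "finite {z \<in> cball 0 r. g z = 0}"
  proof (rule ccontr)
    assume "infinite {z \<in> cball 0 r. g z = 0}"
    then obtain z where "z islimpt {z \<in> cball 0 r. g z = 0}"
      using Heine_Borel_imp_Bolzano_Weierstrass[of "cball 0 r" "{z \<in> cball 0 r. g z = 0}"]
      by (metis (no_types, lifting) compact_cball mem_Collect_eq subsetI)
    then have "z islimpt {z. g z = 0}" by (rule islimpt_subset) auto
    with lim show False by blast
  qed
qed (use fg in auto)

text \<open>A partial sum of the Taylor series is close to \<open>c\<close>, as the series converges uniformly on smaller discs.\<close>
lemma holomorphic_approx_entire:
  fixes c :: "complex \<Rightarrow> complex"
  assumes c: "c holomorphic_on ball 0 R" and "r < R" "e > 0"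
  obtains p where "p holomorphic_on UNIV" "\<And>z. z \<in> cball 0 r \<Longrightarrow> norm (c z - p z) < e"
proof -
  define a where "a n = (deriv ^^ n) c 0 / fact n" for n
  have s: "(\<lambda>n. a n * z ^ n) sums c z" if "z \<in> ball 0 R" for z
    using holomorphic_power_series[OF c that] by (simp add: a_def)
  have "conv_radius a \<ge> R"
  proof (rule conv_radius_geI_ex')
    fix x :: real assume "0 < x" "ereal x < ereal R"
    then show "summable (\<lambda>n. a n * of_real x ^ n)"
      using s[of "of_real x"] by (auto simp: summable_def)
  qed
  with \<open>r < R\<close> have "ereal r < conv_radius a" by (meson less_ereal.simps(1) less_le_trans)
  from powser_uniform_limit[OF this, of 0]
  have "uniform_limit (cball 0 r) (\<lambda>n z. \<Sum>i<n. a i * z ^ i) (\<lambda>z. \<Sum>i. a i * z ^ i) sequentially"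
    by simp
  from uniform_limitD[OF this \<open>e > 0\<close>] obtain N
    where N: "\<forall>z\<in>cball 0 r. dist (\<Sum>i<N. a i * z ^ i) (\<Sum>i. a i * z ^ i) < e"
    by (auto simp: eventually_sequentially)
  show ?thesis
  proof
    show "(\<lambda>z. \<Sum>i<N. a i * z ^ i) holomorphic_on UNIV" by (intro holomorphic_intros)
    fix z :: complex assume z: "z \<in> cball 0 r"
    with \<open>r < R\<close> have "(\<Sum>i. a i * z ^ i) = c z" by (intro sums_unique[symmetric] s) auto
    with N z show "norm (c z - (\<Sum>i<N. a i * z ^ i)) < e"
      by (metis dist_commute dist_norm)
  qed
qed

text \<open>On the disc of radius \<open>m\<close>, the tail of the sequence is a telescoping series dominated by a geometric
  one, so convergence is locally uniform and the limit is holomorphic on every disc.\<close>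
lemma entire_limit:
  fixes s :: "nat \<Rightarrow> complex \<Rightarrow> complex"
  assumes hol: "\<And>k. s k holomorphic_on ball 0 (real k + 1)"
    and close: "\<And>k z. z \<in> cball 0 (real k) \<Longrightarrow> norm (s (Suc k) z - s k z) \<le> (1/2) ^ k"
  obtains A where "A holomorphic_on UNIV" "\<And>z. (\<lambda>k. s k z) \<longlonglongrightarrow> A z"
proof -
  define A where "A z = lim (\<lambda>k. s k z)" for z
  define L where "L m z = s m z + (\<Sum>i. s (Suc (i + m)) z - s (i + m) z)" for m z
  have ul: "uniform_limit (cball 0 (real m)) (\<lambda>n. s (n + m)) (L m) sequentially" for m
  proof -
    have "uniform_limit (cball 0 (real m)) (\<lambda>n z. \<Sum>i<n. s (Suc (i + m)) z - s (i + m) z)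
        (\<lambda>z. \<Sum>i. s (Suc (i + m)) z - s (i + m) z) sequentially"
    proof (rule Weierstrass_m_test)
      fix n and z :: complex assume "z \<in> cball 0 (real m)"
      then have "norm (s (Suc (n + m)) z - s (n + m) z) \<le> (1/2) ^ (n + m)"
        by (intro close) auto
      also have "\<dots> \<le> (1/2) ^ n" by (intro power_decreasing) auto
      finally show "norm (s (Suc (n + m)) z - s (n + m) z) \<le> (1/2) ^ n" .
    qed (auto intro: summable_geometric)
    then have "uniform_limit (cball 0 (real m))
        (\<lambda>n z. s m z + (\<Sum>i<n. s (Suc (i + m)) z - s (i + m) z)) (L m) sequentially"
      unfolding L_def by (intro uniform_limit_intros)
    moreover have "s m z + (\<Sum>i<n. s (Suc (i + m)) z - s (i + m) z) = s (n + m) z" for n z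
      using sum_lessThan_telescope[of "\<lambda>i. s (i + m) z" n] by simp
    ultimately show ?thesis by (simp only:)
  qed
  \<comment> \<open>As \<open>L m\<close> is the pointwise limit on the disc of radius \<open>m\<close>, these functions agree where the discs overlap.\<close>
  have lim: "(\<lambda>k. s k z) \<longlonglongrightarrow> L m z" if "z \<in> cball 0 (real m)" for m z
    using tendsto_uniform_limitI[OF ul that] by (simp add: LIMSEQ_offset[of _ m])
  then have AL: "A z = L m z" if "z \<in> cball 0 (real m)" for m z
    using that limI by (auto simp: A_def)
  have "A holomorphic_on ball 0 (real m)" for m
  proof -
    have "continuous_on (cball 0 (real m)) (s (n + m)) \<and> s (n + m) holomorphic_on ball 0 (real m)" for n
    proof -
      have "s (n + m) holomorphic_on cball 0 (real m)"
        by (rule holomorphic_on_subset[OF hol]) auto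
      then show ?thesis
        by (meson ball_subset_cball holomorphic_on_imp_continuous_on holomorphic_on_subset)
    qed
    then have "L m holomorphic_on ball 0 (real m)"
      using holomorphic_uniform_limit[OF always_eventually ul, of m] by auto
    then show ?thesis by (rule holomorphic_transform) (metis AL ball_subset_cball subsetD)
  qed
  then have "A holomorphic_on (\<Union>m\<in>UNIV. ball 0 (real m))"
    by (intro holomorphic_on_UN_open) auto
  moreover have "(\<Union>m\<in>UNIV. ball 0 (real m)) = (UNIV :: complex set)"
    using reals_Archimedean2 by auto
  ultimately have "A holomorphic_on UNIV" by simp
  moreover have "(\<lambda>k. s k z) \<longlonglongrightarrow> A z" for z
  proof -
    obtain m :: nat where "norm z \<le> real m" using real_arch_simple by blast
    then show ?thesis using lim[of z m] AL[of z m] by simp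
  qed
  ultimately show ?thesis using that by blast
qed

text \<open>Given a solution \<open>(a, b)\<close> of the Bezout equation on a disc, a solution on a larger disc can be chosen
  close to it on a smaller one. Two solutions differ by \<open>(g c, - f c)\<close>, and explicitly
  \<open>c = a' b - a b'\<close>, so \<open>c\<close> is holomorphic without any division. If a polynomial \<open>p\<close> approximates \<open>c\<close>, then
  \<open>(a' - g p, b' + f p)\<close> still solves the equation and differs from \<open>(a, b)\<close> only by
  \<open>(g (c - p), - f (c - p))\<close>.\<close>
lemma comaximal_on_next:
  assumes f: "f holomorphic_on UNIV" and g: "g holomorphic_on UNIV"
    and ab: "a holomorphic_on ball 0 R" "b holomorphic_on ball 0 R"
      "\<And>z. z \<in> ball 0 R \<Longrightarrow> f z * a z + g z * b z = 1"
    and co: "comaximal_on (ball 0 R') f g" and "r < R" "R \<le> R'" "e > 0"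
  obtains a' b' where "a' holomorphic_on ball 0 R'" "b' holomorphic_on ball 0 R'"
      "\<And>z. z \<in> ball 0 R' \<Longrightarrow> f z * a' z + g z * b' z = 1"
      "\<And>z. z \<in> cball 0 r \<Longrightarrow> norm (a' z - a z) \<le> e"
      "\<And>z. z \<in> cball 0 r \<Longrightarrow> norm (b' z - b z) \<le> e"
proof -
  obtain a' b' where ab': "a' holomorphic_on ball 0 R'" "b' holomorphic_on ball 0 R'"
    "\<And>z. z \<in> ball 0 R' \<Longrightarrow> f z * a' z + g z * b' z = 1"
    using co by (auto simp: comaximal_on_def)
  have sub: "ball 0 R \<subseteq> ball (0::complex) R'" using \<open>R \<le> R'\<close> by auto
  define c where "c z = a' z * b z - a z * b' z" for z
  have c: "c holomorphic_on ball 0 R"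
    unfolding c_def using ab(1,2) ab'(1,2) sub
    by (intro holomorphic_intros) (auto intro: holomorphic_on_subset)
  have "bounded (f ` cball 0 r)" "bounded (g ` cball 0 r)"
    using f g by (auto intro!: compact_imp_bounded compact_continuous_image
        holomorphic_on_imp_continuous_on intro: holomorphic_on_subset)
  then obtain B C where B: "\<forall>z\<in>cball 0 r. norm (f z) \<le> B" "B > 0"
      and C: "\<forall>z\<in>cball 0 r. norm (g z) \<le> C" "C > 0"
    by (auto simp: bounded_pos)
  \<comment> \<open>The error of \<open>p\<close> is multiplied by \<open>f\<close> or \<open>g\<close>, both bounded by \<open>B + C\<close> on the small disc.\<close>
  have "e / (B + C) > 0" using B C \<open>e > 0\<close> by simp
  then obtain p where p: "p holomorphic_on UNIV" "\<And>z. z \<in> cball 0 r \<Longrightarrow> norm (c z - p z) < e / (B + C)"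
    using holomorphic_approx_entire[OF c \<open>r < R\<close>] by blast
  have bd: "norm (u z * (c z - p z)) \<le> e" if "z \<in> cball 0 r" "norm (u z) \<le> B + C" for u z
  proof -
    have "norm (u z * (c z - p z)) \<le> (B + C) * (e / (B + C))"
      unfolding norm_mult using that p(2)[OF that(1)] B C by (intro mult_mono) auto
    then show ?thesis using B C by simp
  qed
  have ca: "a' z - a z = g z * c z" and cb: "b' z - b z = - (f z * c z)" if "z \<in> ball 0 R" for z
  proof -
    have 1: "f z * a z + g z * b z = 1" "f z * a' z + g z * b' z = 1"
      using that sub ab(3) ab'(3) by auto
    have "g z * c z = a' z * (g z * b z) - a z * (g z * b' z)" by (simp add: c_def algebra_simps)
    also have "\<dots> = a' z * (1 - f z * a z) - a z * (1 - f z * a' z)"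
      using 1 by (metis add_diff_cancel_left')
    finally show "a' z - a z = g z * c z" by (simp add: algebra_simps)
    have "f z * c z = (f z * a' z) * b z - (f z * a z) * b' z" by (simp add: c_def algebra_simps)
    also have "\<dots> = (1 - g z * b' z) * b z - (1 - g z * b z) * b' z"
      using 1 by (metis add_diff_cancel_right')
    finally show "b' z - b z = - (f z * c z)" by (simp add: algebra_simps)
  qed
  show ?thesis
  proof
    show "(\<lambda>z. a' z - g z * p z) holomorphic_on ball 0 R'"
         "(\<lambda>z. b' z + f z * p z) holomorphic_on ball 0 R'"
      using ab' f g p(1) by (auto intro!: holomorphic_intros intro: holomorphic_on_subset)
  next
    fix z :: complex assume "z \<in> ball 0 R'"
    then show "f z * (a' z - g z * p z) + g z * (b' z + f z * p z) = 1"
      using ab'(3)[of z] by (simp add: algebra_simps)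
  next
    fix z :: complex assume z: "z \<in> cball 0 r"
    then have zR: "z \<in> ball 0 R" using \<open>r < R\<close> by auto
    have "a' z - g z * p z - a z = g z * (c z - p z)"
      using ca[OF zR] by (simp add: algebra_simps)
    then show "norm (a' z - g z * p z - a z) \<le> e"
      using bd[of z g] z B C by fastforce
    have "b' z + f z * p z - b z = - (f z * (c z - p z))"
      using cb[OF zR] by (simp add: algebra_simps)
    then show "norm (b' z + f z * p z - b z) \<le> e"
      using bd[of z f] z B C by fastforce
  qed
qed

text \<open>Solutions exist on every disc; choosing each close to the preceding one makes them converge to a
  solution on the whole plane.\<close>
lemma entire_bezout:
  assumes f: "f holomorphic_on UNIV" and g: "g holomorphic_on UNIV" "g \<noteq> (\<lambda>z. 0)"
    and fg: "\<And>z. \<not> (f z = 0 \<and> g z = 0)"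
  obtains a b where "a holomorphic_on UNIV" "b holomorphic_on UNIV"
    "\<And>z. f z * a z + g z * b z = 1"
proof -
  define good where "good k ab \<longleftrightarrow> fst ab holomorphic_on ball 0 (real k + 1) \<and>
    snd ab holomorphic_on ball 0 (real k + 1) \<and>
    (\<forall>z\<in>ball 0 (real k + 1). f z * fst ab z + g z * snd ab z = 1)"
    for k and ab :: "(complex \<Rightarrow> complex) \<times> (complex \<Rightarrow> complex)"
  define close where "close k ab ab' \<longleftrightarrow> (\<forall>z\<in>cball 0 (real k).
    norm (fst ab' z - fst ab z) \<le> (1/2) ^ k \<and> norm (snd ab' z - snd ab z) \<le> (1/2) ^ k)"
    for k and ab ab' :: "(complex \<Rightarrow> complex) \<times> (complex \<Rightarrow> complex)"
  have co: "comaximal_on (ball 0 r) f g" for r by (rule comaximal_on_ball[OF f g fg])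
  have "\<exists>s. \<forall>k. good k (s k) \<and> close k (s k) (s (Suc k))"
  proof (rule dependent_nat_choice)
    obtain a b where "a holomorphic_on ball 0 1" "b holomorphic_on ball 0 1"
      "\<forall>z\<in>ball 0 1. f z * a z + g z * b z = 1"
      using co[of 1] by (auto simp: comaximal_on_def)
    then show "\<exists>ab. good 0 ab" by (intro exI[of _ "(a, b)"]) (auto simp: good_def)
  next
    fix ab k assume "good k ab"
    then obtain a' b' where "a' holomorphic_on ball 0 (real (Suc k) + 1)"
        "b' holomorphic_on ball 0 (real (Suc k) + 1)"
        "\<And>z. z \<in> ball 0 (real (Suc k) + 1) \<Longrightarrow> f z * a' z + g z * b' z = 1"
        "\<And>z. z \<in> cball 0 (real k) \<Longrightarrow> norm (a' z - fst ab z) \<le> (1/2) ^ k"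
        "\<And>z. z \<in> cball 0 (real k) \<Longrightarrow> norm (b' z - snd ab z) \<le> (1/2) ^ k"
      using comaximal_on_next[OF f g(1) _ _ _ co, of "fst ab" "real k + 1" "snd ab" "real k" "real (Suc k) + 1" "(1/2) ^ k"]
      by (auto simp: good_def)
    then show "\<exists>ab'. good (Suc k) ab' \<and> close k ab ab'"
      by (intro exI[of _ "(a', b')"]) (auto simp: good_def close_def)
  qed
  then obtain s where s: "\<And>k. good k (s k)" "\<And>k. close k (s k) (s (Suc k))" by blast
  obtain a where a: "a holomorphic_on UNIV" "\<And>z. (\<lambda>k. fst (s k) z) \<longlonglongrightarrow> a z"
    by (rule entire_limit[of "\<lambda>k. fst (s k)"]) (use s in \<open>auto simp: good_def close_def\<close>)
  obtain b where b: "b holomorphic_on UNIV" "\<And>z. (\<lambda>k. snd (s k) z) \<longlonglongrightarrow> b z"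
    by (rule entire_limit[of "\<lambda>k. snd (s k)"]) (use s in \<open>auto simp: good_def close_def\<close>)
  have "f z * a z + g z * b z = 1" for z
  proof (rule LIMSEQ_unique)
    show "(\<lambda>k. f z * fst (s k) z + g z * snd (s k) z) \<longlonglongrightarrow> f z * a z + g z * b z"
      by (intro tendsto_intros a b)
    obtain m :: nat where m: "norm z < real m" using reals_Archimedean2 by blast
    have "\<forall>\<^sub>F k in sequentially. f z * fst (s k) z + g z * snd (s k) z = 1"
      using eventually_ge_at_top[of m]
    proof eventually_elim
      case (elim k)
      then have "z \<in> ball 0 (real k + 1)" using m by simp
      then show ?case using s(1)[of k] by (simp add: good_def)
    qed
    then show "(\<lambda>k. f z * fst (s k) z + g z * snd (s k) z) \<longlonglongrightarrow> 1" by (rule tendsto_eventually)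
  qed
  then show ?thesis using that a(1) b(1) by blast
qed

text \<open>The zeros of \<open>f\<close> are distributed according to whether \<open>n\<close> vanishes: \<open>g\<close> has no zero in common with
  \<open>n\<close>, and \<open>h\<close> vanishes only where \<open>n = 0\<close>, that is, where \<open>m = 1\<close>.\<close>
lemma entire_unique_maximal:
  assumes "primeideal P entire_ring" "P \<noteq> {\<zero>\<^bsub>entire_ring\<^esub>}"
  shows "\<exists>!M. maximalideal M entire_ring \<and> P \<subseteq> M"
  unfolding entire_ring_def
proof (rule function_ring_unique_maximal)
  show "primeideal P (function_ring {f. f holomorphic_on UNIV})"
    "P \<noteq> {\<zero>\<^bsub>function_ring {f :: complex \<Rightarrow> complex. f holomorphic_on UNIV}\<^esub>}"
    using assms by (simp_all add: entire_ring_def)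
next
  fix f m n :: "complex \<Rightarrow> complex"
  assume f: "f \<in> {f. f holomorphic_on UNIV}" "f \<noteq> (\<lambda>z. 0)"
    and m: "m \<in> {f. f holomorphic_on UNIV}" and n: "n \<in> {f. f holomorphic_on UNIV}"
    and mn: "\<And>z. m z + n z = 1"
  have fh: "f holomorphic_on UNIV" and mh: "m holomorphic_on UNIV" and nh: "n holomorphic_on UNIV"
    using f m n by simp_all
  obtain g h where gh: "g holomorphic_on UNIV" "h holomorphic_on UNIV" "\<And>z. f z = g z * h z"
    "\<And>z. g z = 0 \<longleftrightarrow> f z = 0 \<and> z \<in> {z. n z \<noteq> 0}"
    "\<And>z. h z = 0 \<longleftrightarrow> f z = 0 \<and> z \<notin> {z. n z \<noteq> 0}"
    by (rule entire_split_zeros[OF fh f(2), where A = "{z. n z \<noteq> 0}"]) (rule that)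
  have nz: "g \<noteq> (\<lambda>z. 0)" "h \<noteq> (\<lambda>z. 0)"
    using f(2) gh(3) by (metis mult_zero_left mult_zero_right)+
  have c1: "\<not> (n z = 0 \<and> g z = 0)" for z
    using gh(4)[of z] by auto
  obtain a b where ab: "a holomorphic_on UNIV" "b holomorphic_on UNIV" "\<And>z. n z * a z + g z * b z = 1"
    by (rule entire_bezout[OF nh gh(1) nz(1) c1]) (rule that)
  have c2: "\<not> (m z = 0 \<and> h z = 0)" for z
    using mn[of z] gh(5)[of z] by auto
  obtain c d where cd: "c holomorphic_on UNIV" "d holomorphic_on UNIV" "\<And>z. m z * c z + h z * d z = 1"
    by (rule entire_bezout[OF mh gh(2) nz(2) c2]) (rule that)
  show "\<exists>e\<in>{f. f holomorphic_on UNIV}. \<exists>g\<in>{f. f holomorphic_on UNIV}. \<exists>h\<in>{f. f holomorphic_on UNIV}.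
     (\<forall>x. g x * h x = e x * f x) \<and>
     (\<exists>a\<in>{f. f holomorphic_on UNIV}. \<exists>b\<in>{f. f holomorphic_on UNIV}. \<forall>x. a x * g x + b x * n x = 1) \<and>
     (\<exists>a\<in>{f. f holomorphic_on UNIV}. \<exists>b\<in>{f. f holomorphic_on UNIV}. \<forall>x. a x * h x + b x * m x = 1)"
  proof (rule bexI[of _ "\<lambda>z. 1"], rule bexI[of _ g], rule bexI[of _ h], intro conjI)
    show "\<exists>a\<in>{f. f holomorphic_on UNIV}. \<exists>b\<in>{f. f holomorphic_on UNIV}. \<forall>x. a x * g x + b x * n x = 1"
      using ab by (intro bexI[of _ b] bexI[of _ a]) (auto simp: mult.commute add.commute)
    show "\<exists>a\<in>{f. f holomorphic_on UNIV}. \<exists>b\<in>{f. f holomorphic_on UNIV}. \<forall>x. a x * h x + b x * m x = 1"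
      using cd by (intro bexI[of _ d] bexI[of _ c]) (auto simp: mult.commute add.commute)
  qed (use gh(1,2) in \<open>simp_all add: gh(3)\<close>)
qed (auto intro: holomorphic_intros)

section \<open>Entire functions with real Taylor coefficients\<close>

definition conj_sym :: "(complex \<Rightarrow> complex) \<Rightarrow> complex \<Rightarrow> complex" where
  "conj_sym f z = cnj (f (cnj z))"

lemma conj_sym_holomorphic: "f holomorphic_on UNIV \<Longrightarrow> conj_sym f holomorphic_on UNIV"
proof -
  assume "f holomorphic_on UNIV"
  then have "cnj \<circ> f \<circ> cnj holomorphic_on UNIV"
    by (intro holomorphic_on_compose_cnj_cnj) (auto intro: holomorphic_on_subset)
  moreover have "cnj \<circ> f \<circ> cnj = conj_sym f" by (simp add: conj_sym_def fun_eq_iff)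
  ultimately show ?thesis by simp
qed

text \<open>Conjugation turns the Taylor series of \<open>f\<close> into that with conjugate coefficients. Conversely, the
  average of the two series has the real parts of the coefficients of \<open>f\<close>, and it still represents \<open>f\<close>
  if \<open>f\<close> is fixed.\<close>
lemma real_entire_iff_conj_sym:
  "(\<exists>a :: nat \<Rightarrow> real. \<forall>z. (\<lambda>n. complex_of_real (a n) * z ^ n) sums f z) \<longleftrightarrow>
     f holomorphic_on UNIV \<and> conj_sym f = f"
proof (intro iffI conjI)
  assume "\<exists>a :: nat \<Rightarrow> real. \<forall>z. (\<lambda>n. complex_of_real (a n) * z ^ n) sums f z"
  then obtain a :: "nat \<Rightarrow> real" where a: "\<And>z. (\<lambda>n. complex_of_real (a n) * z ^ n) sums f z" by blast
  have "f holomorphic_on ball 0 r" for r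
    by (rule power_series_holomorphic[where a = "\<lambda>n. of_real (a n)"]) (use a in simp)
  then have "f holomorphic_on (\<Union>m\<in>UNIV. ball 0 (real m))" by (intro holomorphic_on_UN_open) auto
  moreover have "(\<Union>m\<in>UNIV. ball 0 (real m)) = (UNIV :: complex set)"
    using reals_Archimedean2 by auto
  ultimately show "f holomorphic_on UNIV" by simp
  show "conj_sym f = f"
  proof
    fix z
    have "(\<lambda>n. cnj (complex_of_real (a n) * cnj z ^ n)) sums cnj (f (cnj z))"
      using a[of "cnj z"] by (simp only: sums_cnj)
    then show "conj_sym f z = f z"
      using sums_unique2[OF _ a[of z]] by (simp add: conj_sym_def)
  qed
next
  assume f: "f holomorphic_on UNIV \<and> conj_sym f = f"
  define c where "c n = (deriv ^^ n) f 0 / fact n" for n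
  have c: "(\<lambda>n. c n * z ^ n) sums f z" for z
    using holomorphic_power_series[of f 0 "norm z + 1" z] f
    by (auto simp: c_def intro: holomorphic_on_subset)
  have "(\<lambda>n. complex_of_real (Re (c n)) * z ^ n) sums f z" for z
  proof -
    have "(\<lambda>n. cnj (c n * cnj z ^ n)) sums cnj (f (cnj z))"
      using c[of "cnj z"] by (simp only: sums_cnj)
    moreover have "cnj (f (cnj z)) = f z" using f by (metis conj_sym_def)
    ultimately have "(\<lambda>n. (c n * z ^ n + cnj (c n * cnj z ^ n)) / 2) sums ((f z + f z) / 2)"
      using c[of z] by (intro sums_divide sums_add) simp_all
    moreover have "(c n * z ^ n + cnj (c n * cnj z ^ n)) / 2 = complex_of_real (Re (c n)) * z ^ n" for n
    proof -
      have "c n * z ^ n + cnj (c n * cnj z ^ n) = (c n + cnj (c n)) * z ^ n"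
        by (simp add: algebra_simps)
      then show ?thesis by (simp add: complex_add_cnj)
    qed
    ultimately show ?thesis by simp
  qed
  then show "\<exists>a :: nat \<Rightarrow> real. \<forall>z. (\<lambda>n. complex_of_real (a n) * z ^ n) sums f z"
    by (intro exI[of _ "\<lambda>n. Re (c n)"]) blast
qed

text \<open>If \<open>(a, b)\<close> solves the equation, then so does the conjugate pair, because \<open>f\<close> and \<open>g\<close> are fixed by the
  involution; hence the average solves it as well.\<close>
lemma entire_bezout_conj_sym:
  assumes f: "f holomorphic_on UNIV" "conj_sym f = f"
    and g: "g holomorphic_on UNIV" "conj_sym g = g" "g \<noteq> (\<lambda>z. 0)"
    and fg: "\<And>z. \<not> (f z = 0 \<and> g z = 0)"
  obtains a b where "a holomorphic_on UNIV" "conj_sym a = a" "b holomorphic_on UNIV" "conj_sym b = b"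
    "\<And>z. f z * a z + g z * b z = 1"
proof -
  obtain a b where ab: "a holomorphic_on UNIV" "b holomorphic_on UNIV" "\<And>z. f z * a z + g z * b z = 1"
    using entire_bezout[OF f(1) g(1,3) fg] by blast
  let ?s = "\<lambda>u z. (u z + conj_sym u z) / 2"
  show ?thesis
  proof
    show "?s a holomorphic_on UNIV" "?s b holomorphic_on UNIV"
      using ab conj_sym_holomorphic by (auto intro!: holomorphic_intros)
    show "conj_sym (?s a) = ?s a" "conj_sym (?s b) = ?s b"
      by (auto simp: conj_sym_def fun_eq_iff add.commute)
    fix z
    have "cnj (f (cnj z) * a (cnj z) + g (cnj z) * b (cnj z)) = 1" by (simp add: ab(3))
    then have "f z * conj_sym a z + g z * conj_sym b z = 1"
      using f(2) g(2) by (simp add: conj_sym_def fun_eq_iff)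
    then have "(f z * a z + g z * b z + (f z * conj_sym a z + g z * conj_sym b z)) / 2 = 1"
      using ab(3)[of z] by simp
    moreover have "f z * ?s a z + g z * ?s b z =
        (f z * a z + g z * b z + (f z * conj_sym a z + g z * conj_sym b z)) / 2"
      by (simp add: field_simps)
    ultimately show "f z * ?s a z + g z * ?s b z = 1" by simp
  qed
qed

text \<open>The zeros of \<open>f\<close> and \<open>n\<close> are symmetric about the real axis, so conjugating the factors \<open>g\<close> and \<open>h\<close> of
  \<open>f\<close> does not move their zeros. Hence \<open>G = g g\<^sup>*\<close> and \<open>H = h h\<^sup>*\<close>, where \<open>*\<close> is the involution, have the
  zero sets of \<open>g\<close> and \<open>h\<close>, they are fixed by the involution, and \<open>G H = f f\<^sup>* = f\<^sup>2\<close>.\<close>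
lemma real_entire_unique_maximal:
  assumes "primeideal P real_entire_ring" "P \<noteq> {\<zero>\<^bsub>real_entire_ring\<^esub>}"
  shows "\<exists>!M. maximalideal M real_entire_ring \<and> P \<subseteq> M"
  unfolding real_entire_ring_def real_entire_iff_conj_sym
proof (rule function_ring_unique_maximal)
  show "primeideal P (function_ring {f. f holomorphic_on UNIV \<and> conj_sym f = f})"
    "P \<noteq> {\<zero>\<^bsub>function_ring {f. f holomorphic_on UNIV \<and> conj_sym f = f}\<^esub>}"
    using assms by (simp_all add: real_entire_ring_def real_entire_iff_conj_sym)
next
  let ?F = "{f. f holomorphic_on UNIV \<and> conj_sym f = f}"
  fix f m n :: "complex \<Rightarrow> complex"
  assume f: "f \<in> ?F" "f \<noteq> (\<lambda>z. 0)" and m: "m \<in> ?F" and n: "n \<in> ?F"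
    and mn: "\<And>z. m z + n z = 1"
  have fh: "f holomorphic_on UNIV" and mh: "m holomorphic_on UNIV" and nh: "n holomorphic_on UNIV"
    using f m n by simp_all
  obtain g h where gh: "g holomorphic_on UNIV" "h holomorphic_on UNIV" "\<And>z. f z = g z * h z"
    "\<And>z. g z = 0 \<longleftrightarrow> f z = 0 \<and> z \<in> {z. n z \<noteq> 0}"
    "\<And>z. h z = 0 \<longleftrightarrow> f z = 0 \<and> z \<notin> {z. n z \<noteq> 0}"
    by (rule entire_split_zeros[OF fh f(2), where A = "{z. n z \<noteq> 0}"]) (rule that)
  define G where "G = (\<lambda>z. g z * conj_sym g z)"
  define H where "H = (\<lambda>z. h z * conj_sym h z)"
  have sym: "f (cnj z) = cnj (f z)" "n (cnj z) = cnj (n z)" "m (cnj z) = cnj (m z)" for z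
    using f(1) m n by (metis (mono_tags, lifting) complex_cnj_cnj conj_sym_def mem_Collect_eq)+
  have GF: "G \<in> ?F" and HF: "H \<in> ?F"
    using gh(1,2)[THEN conj_sym_holomorphic] gh(1,2)
    by (simp_all add: G_def H_def holomorphic_on_mult) (simp_all add: conj_sym_def fun_eq_iff mult.commute)
  have G0: "G z = 0 \<longleftrightarrow> g z = 0" and H0: "H z = 0 \<longleftrightarrow> h z = 0" for z
    using gh(4,5)[of z] gh(4,5)[of "cnj z"] by (auto simp: G_def H_def conj_sym_def sym)
  have fGH: "G z * H z = f z * f z" for z
  proof -
    have "G z * H z = (g z * h z) * cnj (g (cnj z) * h (cnj z))"
      by (simp add: G_def H_def conj_sym_def mult_ac)
    also have "\<dots> = f z * f z" by (simp flip: gh(3) add: sym)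
    finally show ?thesis .
  qed
  have nz: "G \<noteq> (\<lambda>z. 0)" "H \<noteq> (\<lambda>z. 0)" 
    using f(2) fGH by (metis mult_zero_left mult_zero_right no_zero_divisors)+
  have c1: "\<not> (n z = 0 \<and> G z = 0)" for z using gh(4)[of z] G0 by auto
  obtain a b where ab: "a \<in> ?F" "b \<in> ?F" "\<And>z. n z * a z + G z * b z = 1"
  proof (rule entire_bezout_conj_sym[OF nh _ _ _ nz(1) c1])
    show "conj_sym n = n" "G holomorphic_on UNIV" "conj_sym G = G" using n GF by simp_all
  qed (use that in simp)
  have c2: "\<not> (m z = 0 \<and> H z = 0)" for z
    using mn[of z] gh(5)[of z] H0 by auto
  obtain c d where cd: "c \<in> ?F" "d \<in> ?F" "\<And>z. m z * c z + H z * d z = 1"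
  proof (rule entire_bezout_conj_sym[OF mh _ _ _ nz(2) c2])
    show "conj_sym m = m" "H holomorphic_on UNIV" "conj_sym H = H" using m HF by simp_all
  qed (use that in simp)
  show "\<exists>e\<in>?F. \<exists>g\<in>?F. \<exists>h\<in>?F. (\<forall>x. g x * h x = e x * f x) \<and>
     (\<exists>a\<in>?F. \<exists>b\<in>?F. \<forall>x. a x * g x + b x * n x = 1) \<and>
     (\<exists>a\<in>?F. \<exists>b\<in>?F. \<forall>x. a x * h x + b x * m x = 1)"
  proof (rule bexI[OF _ f(1)], rule bexI[OF _ GF], rule bexI[OF _ HF], intro conjI)
    show "\<exists>a\<in>?F. \<exists>b\<in>?F. \<forall>x. a x * G x + b x * n x = 1"
      using ab(3) by (intro bexI[OF _ ab(2)] bexI[OF _ ab(1)]) (simp add: mult.commute add.commute)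
    show "\<exists>a\<in>?F. \<exists>b\<in>?F. \<forall>x. a x * H x + b x * m x = 1"
      using cd(3) by (intro bexI[OF _ cd(2)] bexI[OF _ cd(1)]) (simp add: mult.commute add.commute)
  qed (simp add: fGH)
qed (auto simp: conj_sym_def fun_eq_iff intro!: holomorphic_intros)

section \<open>Real analytic functions\<close>

text \<open>At a real centre, taking real parts of the Taylor coefficients of \<open>F\<close> gives the expansion of \<open>Re F\<close> along
  the real line.\<close>
lemma real_analytic_Re_holomorphic:
  assumes A: "open A" "\<real> \<subseteq> A" and F: "F holomorphic_on A"
  shows "real_analytic (\<lambda>x. Re (F (of_real x)))"
  unfolding real_analytic_def
proof
  fix x0 :: real
  obtain r where r: "r > 0" "ball (of_real x0) r \<subseteq> A"
    using A by (metis Reals_of_real open_contains_ball subsetD)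
  have hol: "F holomorphic_on ball (of_real x0) r" using F r(2) by (rule holomorphic_on_subset)
  define a where "a n = Re ((deriv ^^ n) F (of_real x0) / fact n)" for n
  have "(\<lambda>n. a n * (x - x0) ^ n) sums Re (F (of_real x))" if "\<bar>x - x0\<bar> < r" for x
  proof -
    have "complex_of_real x \<in> ball (of_real x0) r"
      using that by (simp add: dist_of_real dist_real_def abs_minus_commute)
    from sums_Re[OF holomorphic_power_series[OF hol this]]
    have "(\<lambda>n. Re ((deriv ^^ n) F (of_real x0) / fact n * (of_real x - of_real x0) ^ n))
        sums Re (F (of_real x))" .
    moreover have "Re ((deriv ^^ n) F (of_real x0) / fact n * (of_real x - of_real x0) ^ n) =
        a n * (x - x0) ^ n" for n
    proof -
      have "(of_real x - of_real x0 :: complex) ^ n = of_real ((x - x0) ^ n)" by simp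
      then show ?thesis unfolding a_def by (simp only: times_complex.sel Re_complex_of_real Im_complex_of_real mult_zero_right diff_0_right)
    qed
    ultimately show ?thesis by simp
  qed
  then show "\<exists>r>0. \<exists>a :: nat \<Rightarrow> real. \<forall>x. \<bar>x - x0\<bar> < r \<longrightarrow>
      (\<lambda>n. a n * (x - x0) ^ n) sums Re (F (of_real x))"
    using r(1) by blast
qed

lemma of_real_islimpt_Reals_inter:
  fixes x :: real
  assumes "open S" "complex_of_real x \<in> S"
  shows "complex_of_real x islimpt (S \<inter> \<real>)"
proof -
  obtain d where d: "d > 0" "ball (complex_of_real x) d \<subseteq> S" using assms open_contains_ball by blast
  show ?thesis
    unfolding islimpt_approachable
  proof (intro allI impI)
    fix e :: real assume "e > 0"
    define y where "y = x + min d e / 2"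
    have y: "y \<noteq> x" "\<bar>y - x\<bar> < d" "\<bar>y - x\<bar> < e" using d(1) \<open>e > 0\<close> by (auto simp: y_def)
    then have "complex_of_real y \<in> ball (complex_of_real x) d"
      by (simp add: dist_of_real dist_real_def abs_minus_commute)
    then show "\<exists>z\<in>S \<inter> \<real>. z \<noteq> complex_of_real x \<and> dist z (complex_of_real x) < e"
      using d(2) y by (intro bexI[of _ "complex_of_real y"]) (auto simp: dist_of_real dist_real_def)
  qed
qed

text \<open>The local power series of \<open>f\<close> converge on complex discs \<open>B p\<close> centred at real points \<open>p\<close>. If two of these
  discs meet, their intersection is convex and contains a real interval, on which both series represent
  \<open>f\<close>; by the identity theorem they agree there and glue to one function.\<close>
lemma real_analytic_extends:
  assumes f: "real_analytic f"
  obtains A F where "open A" "\<real> \<subseteq> A" "F holomorphic_on A"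
    "\<And>x. F (complex_of_real x) = of_real (f x)"
proof -
  from f obtain r a where r: "\<And>p. r p > 0"
    and a: "\<And>p x. \<bar>x - p\<bar> < r p \<Longrightarrow> (\<lambda>n. a p n * (x - p) ^ n :: real) sums f x"
    unfolding real_analytic_def by metis
  define B where "B p = ball (complex_of_real p) (r p)" for p
  define S where "S p z = (\<Sum>n. of_real (a p n) * (z - of_real p) ^ n)" for p and z :: complex
  have sums: "(\<lambda>n. of_real (a p n) * (z - of_real p) ^ n) sums S p z" if "z \<in> B p" for p z
  proof -
    have "norm (z - of_real p) < r p" using that by (simp add: B_def dist_norm norm_minus_commute)
    \<comment> \<open>A real point farther from the centre than \<open>z\<close>: convergence there implies convergence at \<open>z\<close>.\<close>
    then obtain t where t: "norm (z - of_real p) < t" "t < r p" using dense by blast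
    then have t0: "t > 0" using norm_ge_zero le_less_trans by blast
    have "summable (\<lambda>n. a p n * t ^ n)"
      using a[of "p + t" p] t t0 by (auto simp: summable_def)
    then have "summable (\<lambda>n. complex_of_real (a p n * t ^ n))" by (rule summable_of_real)
    then have "summable (\<lambda>n. complex_of_real (a p n) * of_real t ^ n)" by simp
    from powser_inside[OF this, of "z - of_real p"]
    have "summable (\<lambda>n. of_real (a p n) * (z - of_real p) ^ n)" using t t0 by simp
    then show ?thesis unfolding S_def by (rule summable_sums)
  qed
  have S_hol: "S p holomorphic_on B p" for p
    unfolding B_def by (rule power_series_holomorphic[where a = "\<lambda>n. of_real (a p n)"])
      (rule sums[unfolded B_def])
  have S_real: "S p (of_real x) = of_real (f x)" if "complex_of_real x \<in> B p" for p x
  proof -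
    have "\<bar>x - p\<bar> < r p"
      using that by (simp add: B_def dist_of_real dist_real_def abs_minus_commute)
    from sums_of_real[OF a[OF this], where 'a = complex]
    have "(\<lambda>n. of_real (a p n) * (complex_of_real x - of_real p) ^ n) sums of_real (f x)" by simp
    with sums[OF that] show ?thesis by (rule sums_unique2)
  qed
  have agree: "S p z = S q z" if z: "z \<in> B p" "z \<in> B q" for p q z
  proof -
    define D where "D = B p \<inter> B q"
    have Re_in: "complex_of_real (Re z) \<in> B p" if "z \<in> B p" for p
    proof -
      have "dist (complex_of_real p) (of_real (Re z)) \<le> dist (of_real p) z"
        using abs_Re_le_cmod[of "of_real p - z"] unfolding dist_of_real by (simp add: dist_real_def dist_norm)
      then show ?thesis using that by (simp add: B_def)
    qed
    then have ReD: "complex_of_real (Re z) \<in> D" using z by (simp add: D_def)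
    have opD: "open D" by (simp add: D_def B_def open_Int)
    have "S p z - S q z = 0"
    proof (rule analytic_continuation[where f = "\<lambda>z. S p z - S q z" and S = D and U = "D \<inter> \<real>"])
      show "(\<lambda>z. S p z - S q z) holomorphic_on D"
        using S_hol by (intro holomorphic_on_diff) (auto simp: D_def intro: holomorphic_on_subset)
      show "connected D"
        unfolding D_def B_def by (intro convex_connected convex_Int convex_ball)
      show "complex_of_real (Re z) islimpt D \<inter> \<real>" by (rule of_real_islimpt_Reals_inter[OF opD ReD])
      show "S p w - S q w = 0" if "w \<in> D \<inter> \<real>" for w
        using that S_real by (auto simp: D_def elim!: Reals_cases)
    qed (use opD ReD z in \<open>auto simp: D_def\<close>)
    then show ?thesis by simp
  qed
  define F where "F z = S (SOME p. z \<in> B p) z" for z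
  have F_eq: "F z = S p z" if "z \<in> B p" for p z
    unfolding F_def using that by (intro agree) (rule someI)
  have inB: "complex_of_real x \<in> B x" for x using r by (simp add: B_def)
  show ?thesis
  proof
    show "open (\<Union>p. B p)" by (auto simp: B_def)
    show "\<real> \<subseteq> (\<Union>p. B p)" using inB by (auto elim!: Reals_cases)
    have "F holomorphic_on B p" for p
      by (rule holomorphic_transform[OF S_hol]) (simp add: F_eq)
    then show "F holomorphic_on (\<Union>p. B p)"
      by (intro holomorphic_on_UN_open) (auto simp: B_def)
    show "F (complex_of_real x) = of_real (f x)" for x
      using F_eq[OF inB] S_real[OF inB] by simp
  qed
qed

lemma real_analyticI:
  assumes "open A" "\<real> \<subseteq> A" "F holomorphic_on A" "\<And>x. F (complex_of_real x) = of_real (f x)"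
  shows "real_analytic f"
  using real_analytic_Re_holomorphic[OF assms(1-3)] assms(4) by simp

lemma real_analytic_const: "real_analytic (\<lambda>x. c)"
  by (rule real_analyticI[of UNIV "\<lambda>z. of_real c"]) auto

lemma real_analytic_add:
  assumes "real_analytic f" "real_analytic g"
  shows "real_analytic (\<lambda>x. f x + g x)"
proof -
  obtain A F where A: "open A" "\<real> \<subseteq> A" "F holomorphic_on A" "\<And>x. F (complex_of_real x) = of_real (f x)"
    using real_analytic_extends[OF assms(1)] by metis
  obtain B G where B: "open B" "\<real> \<subseteq> B" "G holomorphic_on B" "\<And>x. G (complex_of_real x) = of_real (g x)"
    using real_analytic_extends[OF assms(2)] by metis
  show ?thesis
    by (rule real_analyticI[of "A \<inter> B" "\<lambda>z. F z + G z"])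
      (use A B in \<open>auto intro!: holomorphic_on_add intro: holomorphic_on_subset\<close>)
qed

lemma real_analytic_mult:
  assumes "real_analytic f" "real_analytic g"
  shows "real_analytic (\<lambda>x. f x * g x)"
proof -
  obtain A F where A: "open A" "\<real> \<subseteq> A" "F holomorphic_on A" "\<And>x. F (complex_of_real x) = of_real (f x)"
    using real_analytic_extends[OF assms(1)] by metis
  obtain B G where B: "open B" "\<real> \<subseteq> B" "G holomorphic_on B" "\<And>x. G (complex_of_real x) = of_real (g x)"
    using real_analytic_extends[OF assms(2)] by metis
  show ?thesis
    by (rule real_analyticI[of "A \<inter> B" "\<lambda>z. F z * G z"])
      (use A B in \<open>auto intro!: holomorphic_on_mult intro: holomorphic_on_subset\<close>)
qed

lemma real_analytic_minus: "real_analytic f \<Longrightarrow> real_analytic (\<lambda>x. - f x)"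
  using real_analytic_mult[OF real_analytic_const[of "-1"]] by simp

lemma real_analytic_inverse:
  assumes f: "real_analytic f" and nz: "\<And>x. f x \<noteq> 0"
  shows "real_analytic (\<lambda>x. inverse (f x))"
proof -
  obtain A F where A: "open A" "\<real> \<subseteq> A" "F holomorphic_on A" "\<And>x. F (complex_of_real x) = of_real (f x)"
    using real_analytic_extends[OF f] by metis
  show ?thesis
  proof (rule real_analyticI)
    show "open (A \<inter> F -` (- {0}))"
      using A(1,3) by (intro continuous_open_preimage holomorphic_on_imp_continuous_on) auto
    show "\<real> \<subseteq> A \<inter> F -` (- {0})" using A(2,4) nz by (auto elim!: Reals_cases)
    show "(\<lambda>z. inverse (F z)) holomorphic_on A \<inter> F -` (- {0})"
      using A(3) by (intro holomorphic_on_inverse) (auto intro: holomorphic_on_subset)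
  qed (simp add: A(4))
qed

text \<open>The squared absolute value is the sum of the squares of the real and imaginary parts, and the imaginary
  part of \<open>F\<close> is the real part of \<open>- \<i> F\<close>.\<close>
lemma real_analytic_cmod_square:
  assumes "open A" "\<real> \<subseteq> A" "F holomorphic_on A"
  shows "real_analytic (\<lambda>x. (cmod (F (of_real x)))\<^sup>2)"
proof -
  have "real_analytic (\<lambda>x. Re (F (of_real x)))"
    by (rule real_analytic_Re_holomorphic[OF assms])
  moreover have "real_analytic (\<lambda>x. Re (- \<i> * F (of_real x)))"
    by (rule real_analytic_Re_holomorphic[OF assms(1,2)]) (intro holomorphic_intros assms(3))
  ultimately have "real_analytic (\<lambda>x. Re (F (of_real x)) * Re (F (of_real x)) +
      Re (- \<i> * F (of_real x)) * Re (- \<i> * F (of_real x)))"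
    by (intro real_analytic_add real_analytic_mult)
  moreover have "Re w * Re w + Re (- \<i> * w) * Re (- \<i> * w) = (cmod w)\<^sup>2" for w
    unfolding cmod_power2 by (simp add: power2_eq_square)
  ultimately show ?thesis by simp
qed

text \<open>The function \<open>u\<^sup>2 + v\<^sup>2\<close> has no zeros, hence it is invertible and \<open>u / (u\<^sup>2 + v\<^sup>2)\<close>, \<open>v / (u\<^sup>2 + v\<^sup>2)\<close>
  are Bezout coefficients.\<close>
lemma real_analytic_bezout:
  assumes u: "real_analytic u" and v: "real_analytic v" and "\<And>x. \<not> (u x = 0 \<and> v x = 0)"
  obtains a b where "real_analytic a" "real_analytic b" "\<And>x. a x * u x + b x * v x = 1"
proof -
  define w where "w x = inverse (u x * u x + v x * v x)" for x
  have nz: "u x * u x + v x * v x \<noteq> 0" for x using assms(3)[of x] by (simp add: sum_squares_eq_zero_iff)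
  have w: "real_analytic w"
    unfolding w_def by (intro real_analytic_inverse real_analytic_add real_analytic_mult u v nz)
  show ?thesis
  proof
    show "real_analytic (\<lambda>x. w x * u x)" "real_analytic (\<lambda>x. w x * v x)"
      by (intro real_analytic_mult u v w)+
    show "w x * u x * u x + w x * v x * v x = 1" for x
    proof -
      have "w x * u x * u x + w x * v x * v x = w x * (u x * u x + v x * v x)"
        by (simp add: algebra_simps)
      also have "\<dots> = 1" unfolding w_def by (rule left_inverse[OF nz])
      finally show ?thesis .
    qed
  qed
qed

lemma connected_component_of_Reals:
  assumes "open A" "\<real> \<subseteq> (A :: complex set)"
  obtains C where "open C" "connected C" "\<real> \<subseteq> C" "C \<subseteq> A"
proof
  let ?C = "connected_component_set A 0"
  show "open ?C" by (rule open_connected_component[OF assms(1)])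
  show "connected ?C" by simp
  have "connected (\<real> :: complex set)"
    unfolding Reals_def by (intro connected_continuous_image continuous_intros connected_UNIV)
  then show "\<real> \<subseteq> ?C" using assms(2) by (intro connected_component_maximal) auto
  show "?C \<subseteq> A" by (rule connected_component_subset)
qed

text \<open>The zeros of the extension are isolated, so its nonreal zeros do not accumulate at the real line and can
  be removed from the domain together with their limit points.\<close>
lemma real_analytic_extends_real_zeros:
  assumes f: "real_analytic f" "f \<noteq> (\<lambda>x. 0)"
  obtains A F where "open A" "connected A" "\<real> \<subseteq> A" "F holomorphic_on A"
    "\<And>x. F (complex_of_real x) = of_real (f x)" "\<And>z. z \<in> A \<Longrightarrow> F z = 0 \<Longrightarrow> z \<in> \<real>"
proof -
  obtain A0 F where A0: "open A0" "\<real> \<subseteq> A0" and F0: "F holomorphic_on A0"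
    and Ff: "\<And>x. F (complex_of_real x) = of_real (f x)"
    using real_analytic_extends[OF f(1)] by metis
  obtain A where A: "open A" "connected A" "\<real> \<subseteq> A" "A \<subseteq> A0"
    using connected_component_of_Reals[OF A0] by metis
  have F: "F holomorphic_on A" using F0 A(4) by (rule holomorphic_on_subset)
  obtain b where b: "f b \<noteq> 0" using f(2) by auto
  define N where "N = {z \<in> A. F z = 0 \<and> z \<notin> \<real>}"
  have "z \<notin> closure N" if z: "z \<in> \<real>" for z
  proof -
    have "\<forall>\<^sub>F w in at z. F w \<noteq> 0 \<and> w \<in> A"
      by (rule non_zero_neighbour_alt[OF F A(1,2), of _ "of_real b"]) (use z A(3) b Ff in auto)
    then have "\<not> z islimpt N"
      by (auto simp: islimpt_iff_eventually N_def elim!: eventually_mono)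
    then show ?thesis using z by (simp add: closure_def N_def)
  qed
  then have "open (A - closure N)" "\<real> \<subseteq> A - closure N" using A(1,3) by (auto intro: open_Diff)
  then obtain C where C: "open C" "connected C" "\<real> \<subseteq> C" "C \<subseteq> A - closure N"
    using connected_component_of_Reals by metis
  show ?thesis
  proof
    show "F holomorphic_on C" by (rule holomorphic_on_subset[OF F]) (use C(4) in auto)
    show "z \<in> \<real>" if "z \<in> C" "F z = 0" for z
    proof (rule ccontr)
      assume "z \<notin> \<real>"
      then have "z \<in> N" using that C(4) by (auto simp: N_def)
      then show False using that(1) C(4) closure_subset by blast
    qed
  qed (use C Ff in auto)
qed

text \<open>Take an extension \<open>F\<close> whose zeros are all real. They cannot accumulate on the frontier of its open domain,
  since a limit point of real points is real and thus inside. So the Weierstrass factorization applies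
  to \<open>F\<close> and puts all its zeros into an entire function.\<close>
lemma real_analytic_factor_entire:
  assumes f: "real_analytic f" "f \<noteq> (\<lambda>x. 0)"
  obtains A h G where "open A" "\<real> \<subseteq> A" "h holomorphic_on A" "\<And>z. z \<in> A \<Longrightarrow> h z \<noteq> 0"
    "G holomorphic_on UNIV" "\<And>x. of_real (f x) = h (complex_of_real x) * G (complex_of_real x)"
proof -
  obtain A F where A: "open A" "connected A" "\<real> \<subseteq> A" and F: "F holomorphic_on A"
    and Ff: "\<And>x. F (complex_of_real x) = of_real (f x)" and real0: "\<And>z. z \<in> A \<Longrightarrow> F z = 0 \<Longrightarrow> z \<in> \<real>"
    using real_analytic_extends_real_zeros[OF f] by metis
  have fr: "\<not> z islimpt {w \<in> A. F w = 0}" if "z \<in> frontier A" for z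
  proof
    assume "z islimpt {w \<in> A. F w = 0}"
    then have "z islimpt \<real>" by (rule islimpt_subset) (use real0 in auto)
    then have "z \<in> A" using A(3) closed_complex_Reals closed_limpt by blast
    then show False using that A(1) by (simp add: frontier_def interior_open)
  qed
  obtain h G where hG: "h holomorphic_on A" "G holomorphic_on UNIV" "\<forall>z\<in>A. h z \<noteq> 0"
      "\<forall>z\<in>A. F z = h z * G z"
    by (rule weierstrass_factorization[OF F A(1,2) fr]) blast
  have "of_real (f x) = h (complex_of_real x) * G (complex_of_real x)" for x
    using hG(4) A(3) Ff[of x] by (metis Reals_of_real subsetD)
  then show ?thesis using that[OF A(1,3) hG(1) _ hG(2)] hG(3) by blast
qed

text \<open>Write \<open>f = h G\<close> on the real line, with \<open>G\<close> entire and \<open>h\<close> without zeros, and distribute the zeros of \<open>G\<close>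
  over \<open>G = G\<^sub>1 G\<^sub>2\<close>. The factors need not be real there, but \<open>\<bar>G\<^sub>1\<bar>\<^sup>2\<close> and \<open>\<bar>h G\<^sub>2\<bar>\<^sup>2\<close> are real analytic,
  have the required zeros, and multiply to \<open>\<bar>f\<bar>\<^sup>2 = f\<^sup>2\<close>.\<close>
lemma real_analytic_split_zeros:
  assumes f: "real_analytic f" "f \<noteq> (\<lambda>x. 0)"
  obtains g k where "real_analytic g" "real_analytic k" "\<And>x. g x * k x = f x * f x"
    "\<And>x. g x = 0 \<longleftrightarrow> f x = 0 \<and> x \<in> A" "\<And>x. k x = 0 \<longleftrightarrow> f x = 0 \<and> x \<notin> A"
proof -
  obtain U h G where U: "open U" "\<real> \<subseteq> U" and h: "h holomorphic_on U" "\<And>z. z \<in> U \<Longrightarrow> h z \<noteq> 0"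
    and G: "G holomorphic_on UNIV" and fhG: "\<And>x. of_real (f x) = h (complex_of_real x) * G (complex_of_real x)"
    using real_analytic_factor_entire[OF f] by metis
  have hx: "h (complex_of_real x) \<noteq> 0" for x using h(2) U(2) by (metis Reals_of_real subsetD)
  have G0: "G (complex_of_real x) = 0 \<longleftrightarrow> f x = 0" for x
    using fhG[of x] hx[of x] by (metis mult_eq_0_iff of_real_eq_0_iff)
  have "G \<noteq> (\<lambda>z. 0)" using G0 f(2) by auto
  then obtain G1 G2 where G12: "G1 holomorphic_on UNIV" "G2 holomorphic_on UNIV" "\<And>z. G z = G1 z * G2 z"
    "\<And>z. G1 z = 0 \<longleftrightarrow> G z = 0 \<and> z \<in> of_real ` A" "\<And>z. G2 z = 0 \<longleftrightarrow> G z = 0 \<and> z \<notin> of_real ` A"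
    using entire_split_zeros[OF G, of "of_real ` A"] by metis
  have mem: "complex_of_real x \<in> of_real ` A \<longleftrightarrow> x \<in> A" for x by (auto simp: image_iff)
  show ?thesis
  proof
    show "real_analytic (\<lambda>x. (cmod (G1 (of_real x)))\<^sup>2)"
      by (rule real_analytic_cmod_square[OF open_UNIV _ G12(1)]) simp
    show "real_analytic (\<lambda>x. (cmod (h (of_real x) * G2 (of_real x)))\<^sup>2)"
      by (rule real_analytic_cmod_square[OF U]) (intro holomorphic_intros h holomorphic_on_subset[OF G12(2)], simp)
    fix x
    have "(cmod (G1 (of_real x)))\<^sup>2 * (cmod (h (of_real x) * G2 (of_real x)))\<^sup>2 =
        (cmod (h (of_real x) * G (of_real x)))\<^sup>2"
      by (simp add: norm_mult power_mult_distrib G12(3))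
    also have "\<dots> = f x * f x" by (simp flip: fhG add: power2_eq_square)
    finally show "(cmod (G1 (of_real x)))\<^sup>2 * (cmod (h (of_real x) * G2 (of_real x)))\<^sup>2 = f x * f x" .
    show "(cmod (G1 (of_real x)))\<^sup>2 = 0 \<longleftrightarrow> f x = 0 \<and> x \<in> A"
      by (simp add: G12(4) G0 mem)
    show "(cmod (h (of_real x) * G2 (of_real x)))\<^sup>2 = 0 \<longleftrightarrow> f x = 0 \<and> x \<notin> A"
      by (simp add: G12(5) G0 mem hx)
  qed
qed

lemma real_analytic_unique_maximal:
  assumes "primeideal P real_analytic_ring" "P \<noteq> {\<zero>\<^bsub>real_analytic_ring\<^esub>}"
  shows "\<exists>!M. maximalideal M real_analytic_ring \<and> P \<subseteq> M"
  unfolding real_analytic_ring_def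
proof (rule function_ring_unique_maximal)
  show "primeideal P (function_ring {f. real_analytic f})"
    "P \<noteq> {\<zero>\<^bsub>function_ring {f. real_analytic f}\<^esub>}"
    using assms by (simp_all add: real_analytic_ring_def)
next
  let ?F = "{f. real_analytic f}"
  fix f m n :: "real \<Rightarrow> real"
  assume f: "f \<in> ?F" "f \<noteq> (\<lambda>z. 0)" and m: "m \<in> ?F" and n: "n \<in> ?F"
    and mn: "\<And>x. m x + n x = 1"
  have fa: "real_analytic f" using f by simp
  obtain g k where gk: "real_analytic g" "real_analytic k" "\<And>x. g x * k x = f x * f x"
    "\<And>x. g x = 0 \<longleftrightarrow> f x = 0 \<and> x \<in> {x. n x \<noteq> 0}" "\<And>x. k x = 0 \<longleftrightarrow> f x = 0 \<and> x \<notin> {x. n x \<noteq> 0}"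
    by (rule real_analytic_split_zeros[OF fa f(2), where A = "{x. n x \<noteq> 0}"]) (rule that)
  have "\<not> (g x = 0 \<and> n x = 0)" for x using gk(4)[of x] by auto
  with gk(1) n obtain a b where ab: "real_analytic a" "real_analytic b" "\<And>x. a x * g x + b x * n x = 1"
    using real_analytic_bezout[of g n] by (metis mem_Collect_eq)
  have "\<not> (k x = 0 \<and> m x = 0)" for x using gk(5)[of x] mn[of x] by auto
  with gk(2) m obtain c d where cd: "real_analytic c" "real_analytic d" "\<And>x. c x * k x + d x * m x = 1"
    using real_analytic_bezout[of k m] by (metis mem_Collect_eq)
  show "\<exists>e\<in>?F. \<exists>g\<in>?F. \<exists>h\<in>?F. (\<forall>x. g x * h x = e x * f x) \<and>
     (\<exists>a\<in>?F. \<exists>b\<in>?F. \<forall>x. a x * g x + b x * n x = 1) \<and>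
     (\<exists>a\<in>?F. \<exists>b\<in>?F. \<forall>x. a x * h x + b x * m x = 1)"
    using gk(1-3) ab cd f(1) by blast
qed (auto intro: real_analytic_const real_analytic_add real_analytic_mult real_analytic_minus)

section \<open>The unique maximal ideal above a nonzero prime ideal\<close>

theorem proposition2p15:
  shows "(\<forall>P. primeideal P entire_ring \<and> P \<noteq> {\<zero>\<^bsub>entire_ring\<^esub>} \<longrightarrow>
            (\<exists>!M. maximalideal M entire_ring \<and> P \<subseteq> M)) \<and>
         (\<forall>P. primeideal P real_entire_ring \<and> P \<noteq> {\<zero>\<^bsub>real_entire_ring\<^esub>} \<longrightarrow>
            (\<exists>!M. maximalideal M real_entire_ring \<and> P \<subseteq> M)) \<and>
         (\<forall>P. primeideal P real_analytic_ring \<and> P \<noteq> {\<zero>\<^bsub>real_analytic_ring\<^esub>} \<longrightarrow>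
            (\<exists>!M. maximalideal M real_analytic_ring \<and> P \<subseteq> M))"
  by (intro conjI allI impI; elim conjE;
      rule entire_unique_maximal real_entire_unique_maximal real_analytic_unique_maximal; assumption)

end
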